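(* Let $q \in \mathbb{C}$ with $|q|<1$, let $n \in \mathbb{Z}_{+}$ be a nonnegative integer, let $d \in \mathbb{N}$ with $d \equiv 1 \pmod{2}$, and let $\chi$ be a Dirichlet character with conductor $d$. Then \[ q^{d}E_{n,\chi,q}(d)+E_{n,\chi,q}=[2]_{q}\sum_{k=0}^{d-1}\chi(k)(-q)^{k}k^{n}. \]
   Context: For $x\in\mathbb{C}$ write $[x]_q=\frac{1-q^x}{1-q}$, so $[2]_q=1+q$. For a Dirichlet character $\chi$ of conductor $d$ and $x\in\mathbb{C}$, the generalized $q$-Euler polynomials attached to $\chi$ are defined by the generating function \[ \sum_{n=0}^{\infty}E_{n,\chi,q}(x)\frac{t^{n}}{n!}=[2]_{q}\sum_{k=0}^{\infty}\chi(k)(-q)^{k}e^{(x+k)t}, \] equivalently $E_{n,\chi,q}(x)=[2]_{q}\sum_{k=0}^{\infty}\chi(k)(-q)^{k}(x+k)^{n}$ (with the convention $0^0=1$). The generalized $q$-Euler numbers attached to $\chi$ are $E_{n,\chi,q}=E_{n,\chi,q}(0)=[2]_{q}\sum_{k=0}^{\infty}\chi(k)(-q)^{k}k^{n}$. *)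

theory Defs
  imports "HOL-Complex_Analysis.Complex_Analysis"
begin

definition q_bracket :: "complex \<Rightarrow> complex \<Rightarrow> complex" where
  "q_bracket q x = (1 - q powr x) / (1 - q)"

lemma q_bracket_2: "q \<noteq> 1 \<Longrightarrow> q_bracket q 2 = 1 + q"
proof -
  assume q: "q \<noteq> 1"
  have "q powr 2 = q ^ 2"
    using powr_nat[of q 2] by (cases "q = 0") simp_all
  moreover have "1 - q ^ 2 = (1 + q) * (1 - q)"
    by (simp add: algebra_simps power2_eq_square)
  ultimately show ?thesis using q by (simp add: q_bracket_def)
qed

text \<open>A Dirichlet character modulo \<open>d\<close>, extended to the integers by \<open>0\<close> on the non-units.
  For \<open>d = 1\<close> this is the constant function \<open>1\<close>, so that \<open>chi 0 = 1\<close> in this case.\<close>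

definition dirichlet_character :: "nat \<Rightarrow> (int \<Rightarrow> complex) \<Rightarrow> bool" where
  "dirichlet_character d chi \<longleftrightarrow> d > 0 \<and>
     (\<forall>a b. chi (a * b) = chi a * chi b) \<and>
     (\<forall>a. chi (a + int d) = chi a) \<and>
     (\<forall>a. chi a \<noteq> 0 \<longleftrightarrow> coprime a (int d))"

text \<open>The conductor of a character \<open>chi\<close> modulo \<open>m\<close> is the least modulus from which \<open>chi\<close> is induced.\<close>

definition dirichlet_conductor :: "nat \<Rightarrow> (int \<Rightarrow> complex) \<Rightarrow> nat" where
  "dirichlet_conductor m chi =
     (LEAST d. d dvd m \<and>
        (\<exists>\<psi>. dirichlet_character d \<psi> \<and> (\<forall>a. coprime a (int m) \<longrightarrow> chi a = \<psi> a)))"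

text \<open>A character with conductor \<open>d\<close> is understood as a character modulo \<open>d\<close> whose conductor is
  \<open>d\<close> itself, i.e. a primitive character.\<close>

definition dirichlet_character_with_conductor :: "nat \<Rightarrow> (int \<Rightarrow> complex) \<Rightarrow> bool" where
  "dirichlet_character_with_conductor d chi \<longleftrightarrow>
     dirichlet_character d chi \<and> dirichlet_conductor d chi = d"

definition q_Euler_gf :: "(int \<Rightarrow> complex) \<Rightarrow> complex \<Rightarrow> complex \<Rightarrow> complex \<Rightarrow> complex" where
  "q_Euler_gf chi q x t =
     q_bracket q 2 * (\<Sum>k. chi (int k) * (- q) ^ k * exp ((x + of_nat k) * t))"

definition q_Euler_poly :: "nat \<Rightarrow> (int \<Rightarrow> complex) \<Rightarrow> complex \<Rightarrow> complex \<Rightarrow> complex" where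
  "q_Euler_poly n chi q x = fact n * fps_nth (fps_expansion (q_Euler_gf chi q x) 0) n"

definition q_Euler_number :: "nat \<Rightarrow> (int \<Rightarrow> complex) \<Rightarrow> complex \<Rightarrow> complex" where
  "q_Euler_number n chi q = q_Euler_poly n chi q 0"

lemma dirichlet_character_bounded:
  assumes "dirichlet_character d chi"
  obtains M where "M > 0" "\<And>a. norm (chi a) \<le> M"
proof -
  have d: "d > 0" and per: "\<And>a. chi (a + int d) = chi a"
    using assms by (auto simp: dirichlet_character_def)
  have per_nat: "chi (a + int j * int d) = chi a" for a j
  proof (induction j)
    case (Suc j)
    have "chi (a + int (Suc j) * int d) = chi ((a + int j * int d) + int d)"
      by (simp add: algebra_simps)
    then show ?case using per Suc by simp
  qed auto
  have per_int: "chi (a + j * int d) = chi a" for a j :: int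
  proof (cases "j \<ge> 0")
    case True
    then show ?thesis using per_nat[of a "nat j"] by simp
  next
    case False
    then show ?thesis using per_nat[of "a + j * int d" "nat (- j)"] by simp
  qed
  let ?M = "1 + (\<Sum>a\<in>{0..<int d}. norm (chi a))"
  have "norm (chi a) \<le> ?M" for a
  proof -
    have "chi a = chi (a mod int d)"
      using per_int[of "a mod int d" "a div int d"] by simp
    moreover have "a mod int d \<in> {0..<int d}" using d by simp
    then have "norm (chi (a mod int d)) \<le> (\<Sum>a\<in>{0..<int d}. norm (chi a))"
      by (intro member_le_sum) auto
    ultimately show ?thesis by simp
  qed
  moreover have "?M > 0" by (smt (verit) sum_nonneg norm_ge_zero)
  ultimately show ?thesis using that by blast
qed

lemma power_le_fact_exp:
  fixes y r :: real
  assumes "r > 0" "y \<ge> 0"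
  shows "y ^ n \<le> fact n / r ^ n * exp (r * y)"
proof -
  have "(r * y) ^ n / fact n \<le> exp (r * y)"
  proof -
    have s: "(\<lambda>n. (r * y) ^ n /\<^sub>R fact n) sums exp (r * y)" by (rule exp_converges)
    have "(\<Sum>i\<in>{n}. (r * y) ^ i /\<^sub>R fact i) \<le> (\<Sum>i. (r * y) ^ i /\<^sub>R fact i)"
      using s assms by (intro sum_le_suminf) (auto simp: sums_iff)
    then show ?thesis using s by (simp add: sums_iff divide_simps)
  qed
  then show ?thesis using assms by (simp add: field_simps power_mult_distrib)
qed

lemma q_Euler_gf_higher_deriv:
  assumes "norm q < 1" and chi: "dirichlet_character d chi"
  obtains r where "r > 0" "q_Euler_gf chi q x holomorphic_on ball 0 r"
    "\<And>n t. t \<in> ball 0 r \<Longrightarrow> (deriv ^^ n) (q_Euler_gf chi q x) t =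
       q_bracket q 2 * (\<Sum>k. chi (int k) * (- q) ^ k * (x + of_nat k) ^ n * exp ((x + of_nat k) * t))"
proof -
  obtain M where M: "M > 0" "\<And>a. norm (chi a) \<le> M" using dirichlet_character_bounded[OF chi] by blast
  have "((\<lambda>r. norm q * exp (2 * r)) \<longlongrightarrow> norm q * exp (2 * 0)) (at_right 0)"
    by (intro tendsto_intros)
  then have "eventually (\<lambda>r. norm q * exp (2 * r) < 1) (at_right 0)"
    using assms(1) by (intro order_tendstoD(2)) auto
  then have "eventually (\<lambda>r. norm q * exp (2 * r) < 1 \<and> r > 0) (at_right 0)"
    by (intro eventually_conj) (auto simp: eventually_at_right_less)
  then obtain r where r: "r > 0" "norm q * exp (2 * r) < 1"
    using eventually_happens'[OF trivial_limit_at_right_real] by blast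
  define f where "f n k t = chi (int k) * (- q) ^ k * (x + of_nat k) ^ n * exp ((x + of_nat k) * t)"
    for n k t
  define C where "C n = M * (fact n / r ^ n) * exp (2 * r * norm x)" for n
  define h where "h n k = C n * (norm q * exp (2 * r)) ^ k" for n k
  have h: "summable (h n)" for n
    unfolding h_def using r by (intro summable_mult summable_geometric) auto
  have fh: "norm (f n k t) \<le> h n k" if "t \<in> ball 0 r" for n k t
  proof -
    let ?y = "norm x + real k"
    have y: "norm (x + of_nat k) \<le> ?y" by (metis norm_of_nat norm_triangle_ineq)
    have "norm (x + of_nat k) ^ n \<le> ?y ^ n" by (intro power_mono y) auto
    also have "\<dots> \<le> fact n / r ^ n * exp (r * ?y)" using r by (intro power_le_fact_exp) auto
    finally have 1: "norm ((x + of_nat k) ^ n) \<le> fact n / r ^ n * exp (r * ?y)"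
      by (simp add: norm_power)
    have "norm (exp ((x + of_nat k) * t)) \<le> exp (norm ((x + of_nat k) * t))"
      by (rule norm_exp)
    also have "norm ((x + of_nat k) * t) \<le> r * ?y"
      using mult_mono[of "norm t" r, OF _ y] that r by (simp add: norm_mult mult.commute)
    then have "exp (norm ((x + of_nat k) * t)) \<le> exp (r * ?y)" by simp
    finally have 2: "norm (exp ((x + of_nat k) * t)) \<le> exp (r * ?y)" .
    have "norm (f n k t) = norm (chi (int k)) * norm q ^ k *
        norm ((x + of_nat k) ^ n) * norm (exp ((x + of_nat k) * t))"
      by (simp add: f_def norm_mult norm_power)
    also have "\<dots> \<le> M * norm q ^ k * (fact n / r ^ n * exp (r * ?y)) * exp (r * ?y)"
      using M 1 2 r by (intro mult_mono) auto
    also have "\<dots> = M * (fact n / r ^ n) * norm q ^ k * (exp (r * ?y) * exp (r * ?y))"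
      by (simp only: mult_ac)
    also have "exp (r * ?y) * exp (r * ?y) = exp (2 * r * ?y)"
      by (simp only: mult_exp_exp) simp
    also have "exp (2 * r * ?y) = exp (2 * r * norm x) * exp (2 * r) ^ k"
      by (simp only: exp_of_nat_mult[symmetric] mult_exp_exp) (simp add: algebra_simps)
    finally show ?thesis by (simp add: h_def C_def power_mult_distrib mult_ac)
  qed
  have der: "((\<lambda>t. \<Sum>k. f n k t) has_field_derivative (\<Sum>k. f (Suc n) k t)) (at t)"
    if t: "t \<in> ball 0 r" for n t
  proof -
    have "(f n k has_field_derivative f (Suc n) k u) (at u)" for k u
      unfolding f_def by (auto intro!: derivative_eq_intros)
    moreover have "\<forall>\<^sub>F k in sequentially. \<forall>u\<in>ball 0 r. norm (f n k u) \<le> h n k"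
      using fh by simp
    ultimately obtain g g' where g: "\<forall>u\<in>ball 0 r. (\<lambda>k. f n k u) sums g u \<and> (\<lambda>k. f (Suc n) k u) sums g' u \<and>
        (g has_field_derivative g' u) (at u)"
      by (rule series_and_derivative_comparison[OF open_ball h])
    have "(g has_field_derivative (\<Sum>k. f (Suc n) k t)) (at t)"
      using bspec[OF g t] by (simp add: sums_iff)
    then show ?thesis
      by (rule has_field_derivative_transform_within_open[where S = "ball 0 r"])
         (use g t in \<open>auto simp: sums_iff\<close>)
  qed
  have gf: "q_Euler_gf chi q x = (\<lambda>t. q_bracket q 2 * (\<Sum>k. f 0 k t))"
    by (auto simp: q_Euler_gf_def f_def)
  have main: "(deriv ^^ n) (q_Euler_gf chi q x) t = q_bracket q 2 * (\<Sum>k. f n k t)"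
    if "t \<in> ball 0 r" for n t
    using that
  proof (induction n arbitrary: t)
    case 0
    then show ?case by (simp add: gf)
  next
    case (Suc n)
    have "((\<lambda>t. q_bracket q 2 * (\<Sum>k. f n k t)) has_field_derivative
        q_bracket q 2 * (\<Sum>k. f (Suc n) k t)) (at t)"
      by (intro DERIV_cmult der Suc.prems)
    then have "((deriv ^^ n) (q_Euler_gf chi q x) has_field_derivative
        q_bracket q 2 * (\<Sum>k. f (Suc n) k t)) (at t)"
      by (rule has_field_derivative_transform_within_open[where S = "ball 0 r"])
         (use Suc in auto)
    then show ?case by (simp add: DERIV_imp_deriv)
  qed
  have "q_Euler_gf chi q x holomorphic_on ball 0 r"
    unfolding gf holomorphic_on_open[OF open_ball] by (intro ballI exI, rule DERIV_cmult, erule der)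
  then show ?thesis by (rule that[OF r(1) _ main[unfolded f_def]])
qed

lemma q_Euler_poly_generating_function:
  assumes "norm q < 1" "dirichlet_character d chi"
  shows "\<forall>\<^sub>F t in nhds 0. (\<lambda>n. q_Euler_poly n chi q x * t ^ n / fact n) sums q_Euler_gf chi q x t"
proof -
  obtain r where r: "r > 0" "q_Euler_gf chi q x holomorphic_on ball 0 r"
    by (rule q_Euler_gf_higher_deriv[OF assms])
  have "(\<lambda>n. q_Euler_poly n chi q x * t ^ n / fact n) sums q_Euler_gf chi q x t"
    if "t \<in> ball 0 r" for t
    using holomorphic_power_series[OF r(2) that] by (simp add: q_Euler_poly_def fps_expansion_def)
  then show ?thesis
    using r(1) by (auto simp: eventually_nhds intro!: exI[of _ "ball 0 r"])
qed

lemma q_Euler_poly_eq: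
  assumes "norm q < 1" "dirichlet_character d chi"
  shows "q_Euler_poly n chi q x =
    q_bracket q 2 * (\<Sum>k. chi (int k) * (- q) ^ k * (x + of_nat k) ^ n)"
proof -
  have "(deriv ^^ n) (q_Euler_gf chi q x) 0 =
      q_bracket q 2 * (\<Sum>k. chi (int k) * (- q) ^ k * (x + of_nat k) ^ n)"
  proof (rule q_Euler_gf_higher_deriv[OF assms, of x])
    fix r :: real
    assume "r > 0" and "\<And>n t. t \<in> ball 0 r \<Longrightarrow> (deriv ^^ n) (q_Euler_gf chi q x) t =
       q_bracket q 2 * (\<Sum>k. chi (int k) * (- q) ^ k * (x + of_nat k) ^ n * exp ((x + of_nat k) * t))"
    from this(2)[of 0 n] this(1) show ?thesis by simp
  qed
  then show ?thesis by (simp add: q_Euler_poly_def fps_expansion_def)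
qed

end

theory Submission
  imports Defs
begin

text \<open>By \<open>q_Euler_poly_eq\<close>, both Euler terms are \<open>q_bracket q 2\<close>
  times explicit series. Cut the series of the number at k = d. In the tail, replacing k by k + d
  leaves the character unchanged by periodicity and turns the power into (k + d)^n, the summand of
  the polynomial at d; since d is odd, it also produces the factor (-q)^d = -q^d. So the tail is
  -q^d times the series of the polynomial, and moving it across leaves the finite sum. The cut
  requires convergence of the series, which the two summability lemmas provide.\<close>

lemma summable_of_nat_power_mult_power:
  fixes z :: "'a :: {real_normed_field, banach}"
  assumes "norm z < 1"
  shows "summable (\<lambda>k. norm (of_nat k ^ n * z ^ k))"
proof -
  obtain c where c: "norm z < c" "c < 1"
    using assms dense by blast
  then have c0: "0 < c"
    by (meson le_less_trans norm_ge_zero)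
  \<comment> \<open>Chosen so that exp (r k) = c^(-k): \<open>power_le_fact_exp\<close> then bounds
    k^n by a constant times c^(-k), leaving a geometric series of ratio |z| / c < 1.\<close>
  define r where "r = - ln c"
  have r: "r > 0" "exp r = 1 / c"
    using c c0 by (auto simp: r_def exp_minus field_simps)
  have "norm (of_nat k ^ n * z ^ k) \<le> fact n / r ^ n * (norm z / c) ^ k" for k
  proof -
    have "real k ^ n \<le> fact n / r ^ n * exp (r * real k)"
      using r by (intro power_le_fact_exp) auto
    also have "exp (r * real k) = (1 / c) ^ k"
      using r(2) exp_of_nat_mult[of k r] by (simp add: mult.commute)
    finally have "real k ^ n * norm z ^ k \<le> fact n / r ^ n * (1 / c) ^ k * norm z ^ k"
      by (intro mult_right_mono) auto
    then show ?thesis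
      by (simp add: norm_mult norm_power power_divide)
  qed
  moreover have "summable (\<lambda>k. fact n / r ^ n * (norm z / c) ^ k)"
    using c c0 by (intro summable_mult summable_geometric) auto
  ultimately show ?thesis
    by - (rule summable_comparison_test'[where N = 0], assumption, simp)
qed

text \<open>A character is periodic, hence bounded, so a constant multiple of the series of |k^n
  (-q)^k| dominates.\<close>

lemma summable_dirichlet_character_q_power:
  assumes "norm q < 1" "dirichlet_character d chi"
  shows "summable (\<lambda>k. chi (int k) * (- q) ^ k * of_nat k ^ n)"
proof -
  obtain M where M: "\<And>a. norm (chi a) \<le> M"
    using dirichlet_character_bounded[OF assms(2)] by blast
  have "summable (\<lambda>k. M * norm (of_nat k ^ n * (- q) ^ k))"
    using assms(1) by (intro summable_mult summable_of_nat_power_mult_power) simp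
  moreover have "norm (chi (int k) * (- q) ^ k * of_nat k ^ n) \<le> M * norm (of_nat k ^ n * (- q) ^ k)" for k
    using mult_right_mono[OF M, of "norm (of_nat k ^ n * (- q) ^ k)" "int k"]
    by (simp add: norm_mult mult_ac)
  ultimately show ?thesis
    by (rule summable_comparison_test'[where N = 0])
qed

theorem theorem1:
  fixes q :: complex and n d :: nat and chi :: "int \<Rightarrow> complex"
  assumes "norm q < 1"
    and "d > 0" and "d mod 2 = 1"
    and "dirichlet_character_with_conductor d chi"
  shows "q ^ d * q_Euler_poly n chi q (of_nat d) + q_Euler_number n chi q =
    q_bracket q 2 * (\<Sum>k = 0..d-1. chi (int k) * (- q) ^ k * of_nat k ^ n)"
proof -
  have chi: "dirichlet_character d chi"
    using assms(4) by (simp add: dirichlet_character_with_conductor_def)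
  define g where "g k = chi (int k) * (- q) ^ k * of_nat k ^ n" for k
  define h where "h k = chi (int k) * (- q) ^ k * (of_nat d + of_nat k) ^ n" for k
  have g: "summable g"
    unfolding g_def by (rule summable_dirichlet_character_q_power[OF assms(1) chi])
  have "odd d"
    using assms(3) by presburger
  then have sign: "(- q) ^ d = - (q ^ d)"
    by (rule power_minus_odd)
  have per: "chi (int (k + d)) = chi (int k)" for k
    using chi by (simp add: dirichlet_character_def)
  \<comment> \<open>Periodicity and the parity of d enter together here.\<close>
  have shift: "g (k + d) = - (q ^ d) * h k" for k
    unfolding g_def h_def per power_add sign
    by (simp add: ac_simps)
  have "summable (\<lambda>k. - (q ^ d) * h k)"
    using summable_ignore_initial_segment[OF g, of d] unfolding shift .
  \<comment> \<open>Summability of \<open>h\<close> is read off the tail of \<open>g\<close> by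
    cancelling -q^d, which requires q \<noteq> 0. If q = 0, then d > 0 makes this factor vanish, and
    both sides of the next equation are 0.\<close>
  then have "q = 0 \<or> summable h"
    using summable_cmult_iff[of "- (q ^ d)" h] by auto
  then have "(\<Sum>k. - (q ^ d) * h k) = - (q ^ d) * suminf h"
  proof
    assume "q = 0"
    then show ?thesis
      using assms(2) by (simp add: zero_power)
  next
    assume "summable h"
    then show ?thesis
      by (rule suminf_mult)
  qed
  then have "sum g {..<d} = suminf g + q ^ d * suminf h"
    using suminf_split_initial_segment[OF g, of d] unfolding shift by simp
  \<comment> \<open>Subtraction is truncated: at d = 0 the right-hand set would be {0}, so d > 0
    matters.\<close>
  moreover have "{..<d} = {0..d-1}"
    using assms(2) by auto
  ultimately have "sum g {0..d-1} = suminf g + q ^ d * suminf h"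
    by metis
  moreover have "q_Euler_poly n chi q (of_nat d) = q_bracket q 2 * suminf h"
    unfolding q_Euler_poly_eq[OF assms(1) chi] h_def ..
  moreover have "q_Euler_number n chi q = q_bracket q 2 * suminf g"
    unfolding q_Euler_number_def q_Euler_poly_eq[OF assms(1) chi] g_def by simp
  ultimately show ?thesis
    unfolding g_def[symmetric] by (simp add: algebra_simps)
qed

end
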